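(* Let $X$ be a Gromov manifold. If $u$ is an upper semi-continuous function on $X$ which is Lagrangian plurisubharmonic, then $u$ is subharmonic.
   Context: A Gromov manifold is a triple $(X,\omega,J)$ where $(X,\omega)$ is a symplectic manifold of real dimension $2n$ and $J$ is an almost complex structure with $\omega(v,w)=\omega(Jv,Jw)$ and $\omega(Jv,v)>0$ for all non-zero tangent vectors. It carries the riemannian metric $\langle v,w\rangle=\omega(Jv,w)$, with Levi-Civita connection $\nabla$ and riemannian Hessian $(\mathrm{Hess}\,f)(v,w)=vwf-(\nabla_vw)f$. An upper semi-continuous $u:X\to[-\infty,\infty)$ is Lagrangian plurisubharmonic if for each $x\in X$ and each test function $\varphi$ for $u$ at $x$ (smooth near $x$, $u\le\varphi$ near $x$, equality at $x$) one has $\mathrm{tr}(\mathrm{Hess}_x\varphi|_W)\ge0$ for every Lagrangian $n$-plane $W\subset T_xX$ (i.e. $\omega|_W=0$). Subharmonic is with respect to the Laplace-Beltrami operator $\Delta=\mathrm{tr}\,\mathrm{Hess}$ (in the viscosity sense: $\Delta\varphi(x)\ge0$ for each test function $\varphi$ for $u$ at $x$, which is equivalent to the other usual notions). *)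

theory Defs
  imports "HOL-Analysis.Analysis" "HOL-Library.Function_Algebras"
begin

section \<open>Smooth manifolds\<close>

primrec Ck_on :: "nat \<Rightarrow> 'e::real_normed_vector set \<Rightarrow> ('e \<Rightarrow> 'f::real_normed_vector) \<Rightarrow> bool" where
  "Ck_on 0 S f \<longleftrightarrow> continuous_on S f"
| "Ck_on (Suc k) S f \<longleftrightarrow>
     (\<forall>x\<in>S. f differentiable (at x)) \<and> (\<forall>v. Ck_on k S (\<lambda>x. frechet_derivative f (at x) v))"

text \<open>Used for open sets \<open>S\<close> of a finite-dimensional space only.\<close>

definition smooth_on :: "'e::euclidean_space set \<Rightarrow> ('e \<Rightarrow> 'f::real_normed_vector) \<Rightarrow> bool" where
  "smooth_on S f \<longleftrightarrow> (\<forall>k. Ck_on k S f)"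

text \<open>
  The points of the manifold are all the elements of the type \<open>'a\<close>. A chart is a pair
  \<open>(U, \<kappa>)\<close>; the values of \<open>\<kappa>\<close> outside \<open>U\<close> are irrelevant. The atlas need not be
  maximal: enlarging it within its smooth structure changes none of the notions below.
\<close>

type_synonym ('a, 'e) chart = "'a set \<times> ('a \<Rightarrow> 'e)"

definition is_chart :: "('a::topological_space, 'e::euclidean_space) chart \<Rightarrow> bool" where
  "is_chart c \<longleftrightarrow> (case c of (U, \<kappa>) \<Rightarrow>
     open U \<and> open (\<kappa> ` U) \<and> homeomorphism U (\<kappa> ` U) \<kappa> (inv_into U \<kappa>))"

definition smooth_atlas :: "('a::topological_space, 'e::euclidean_space) chart set \<Rightarrow> bool" where
  "smooth_atlas A \<longleftrightarrow>
     (\<forall>c\<in>A. is_chart c) \<and>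
     (\<Union>(U, \<kappa>)\<in>A. U) = UNIV \<and>
     (\<forall>(U, \<kappa>)\<in>A. \<forall>(V, \<mu>)\<in>A. smooth_on (\<kappa> ` (U \<inter> V)) (\<mu> \<circ> inv_into U \<kappa>))"

definition smooth_fun ::
  "('a::topological_space, 'e::euclidean_space) chart set \<Rightarrow> 'a set \<Rightarrow> ('a \<Rightarrow> real) \<Rightarrow> bool" where
  "smooth_fun A S f \<longleftrightarrow> (\<forall>(U, \<kappa>)\<in>A. smooth_on (\<kappa> ` (U \<inter> S)) (f \<circ> inv_into U \<kappa>))"

definition smooth_near ::
  "('a::topological_space, 'e::euclidean_space) chart set \<Rightarrow> 'a \<Rightarrow> ('a \<Rightarrow> real) \<Rightarrow> bool" where
  "smooth_near A x f \<longleftrightarrow> (\<exists>S. open S \<and> x \<in> S \<and> smooth_fun A S f)"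

section \<open>Tangent vectors and vector fields\<close>

text \<open>
  A tangent vector at \<open>x\<close> is a directional derivative acting on the functions that are smooth
  near \<open>x\<close>. To have equality of tangent vectors coincide with equality of HOL functions, it is
  set to \<open>0\<close> on all other functions. Sums and real multiples are pointwise.
\<close>

instantiation "fun" :: (type, real_vector) real_vector
begin

definition scaleR_fun :: "real \<Rightarrow> ('a \<Rightarrow> 'b) \<Rightarrow> 'a \<Rightarrow> 'b" where
  "scaleR_fun r f = (\<lambda>x. r *\<^sub>R f x)"

instance
  by standard (simp_all add: scaleR_fun_def fun_eq_iff scaleR_add_right scaleR_add_left)

end

type_synonym 'a tvec = "('a \<Rightarrow> real) \<Rightarrow> real"

definition coord_tvec ::
  "('a::topological_space, 'e::euclidean_space) chart set \<Rightarrow> ('a, 'e) chart \<Rightarrow> 'a \<Rightarrow> 'e \<Rightarrow> 'a tvec" where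
  "coord_tvec A c x \<xi> = (case c of (U, \<kappa>) \<Rightarrow>
     (\<lambda>f. if smooth_near A x f
          then frechet_derivative (f \<circ> inv_into U \<kappa>) (at (\<kappa> x)) \<xi> else 0))"

definition tangent_space ::
  "('a::topological_space, 'e::euclidean_space) chart set \<Rightarrow> 'a \<Rightarrow> 'a tvec set" where
  "tangent_space A x = {coord_tvec A (U, \<kappa>) x \<xi> | U \<kappa> \<xi>. (U, \<kappa>) \<in> A \<and> x \<in> U}"

definition vector_field ::
  "('a::topological_space, 'e::euclidean_space) chart set \<Rightarrow> 'a set \<Rightarrow> ('a \<Rightarrow> 'a tvec) \<Rightarrow> bool" where
  "vector_field A S V \<longleftrightarrow>
     (\<forall>x\<in>S. V x \<in> tangent_space A x) \<and>
     (\<forall>S' f. open S' \<and> S' \<subseteq> S \<and> smooth_fun A S' f \<longrightarrow> smooth_fun A S' (\<lambda>x. V x f))"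

definition vector_field_near ::
  "('a::topological_space, 'e::euclidean_space) chart set \<Rightarrow> 'a \<Rightarrow> ('a \<Rightarrow> 'a tvec) \<Rightarrow> bool" where
  "vector_field_near A x V \<longleftrightarrow> (\<exists>S. open S \<and> x \<in> S \<and> vector_field A S V)"

definition lie_bracket ::
  "('a::topological_space, 'e::euclidean_space) chart set \<Rightarrow>
     ('a \<Rightarrow> 'a tvec) \<Rightarrow> ('a \<Rightarrow> 'a tvec) \<Rightarrow> 'a \<Rightarrow> 'a tvec" where
  "lie_bracket A V W x =
     (\<lambda>f. if smooth_near A x f then V x (\<lambda>y. W y f) - W x (\<lambda>y. V y f) else 0)"

definition linear_on_subspace :: "'v::real_vector set \<Rightarrow> ('v \<Rightarrow> 'w::real_vector) \<Rightarrow> bool" where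
  "linear_on_subspace T L \<longleftrightarrow>
     (\<forall>a b. \<forall>v\<in>T. \<forall>w\<in>T. L (a *\<^sub>R v + b *\<^sub>R w) = a *\<^sub>R L v + b *\<^sub>R L w)"

section \<open>Gromov manifolds\<close>

definition smooth_2form ::
  "('a::topological_space, 'e::euclidean_space) chart set \<Rightarrow> ('a \<Rightarrow> 'a tvec \<Rightarrow> 'a tvec \<Rightarrow> real) \<Rightarrow> bool" where
  "smooth_2form A \<omega> \<longleftrightarrow>
     (\<forall>x. \<forall>v\<in>tangent_space A x.
        linear_on_subspace (tangent_space A x) (\<omega> x v) \<and>
        linear_on_subspace (tangent_space A x) (\<lambda>w. \<omega> x w v) \<and>
        \<omega> x v v = 0) \<and>
     (\<forall>S V W. open S \<and> vector_field A S V \<and> vector_field A S W \<longrightarrow>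
        smooth_fun A S (\<lambda>x. \<omega> x (V x) (W x)))"

definition closed_2form ::
  "('a::topological_space, 'e::euclidean_space) chart set \<Rightarrow> ('a \<Rightarrow> 'a tvec \<Rightarrow> 'a tvec \<Rightarrow> real) \<Rightarrow> bool" where
  "closed_2form A \<omega> \<longleftrightarrow>
     (\<forall>x V1 V2 V3. vector_field_near A x V1 \<and> vector_field_near A x V2 \<and> vector_field_near A x V3 \<longrightarrow>
        V1 x (\<lambda>y. \<omega> y (V2 y) (V3 y)) - V2 x (\<lambda>y. \<omega> y (V1 y) (V3 y)) + V3 x (\<lambda>y. \<omega> y (V1 y) (V2 y))
        - \<omega> x (lie_bracket A V1 V2 x) (V3 x) + \<omega> x (lie_bracket A V1 V3 x) (V2 x)
        - \<omega> x (lie_bracket A V2 V3 x) (V1 x) = 0)"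

definition symplectic_form ::
  "('a::topological_space, 'e::euclidean_space) chart set \<Rightarrow> ('a \<Rightarrow> 'a tvec \<Rightarrow> 'a tvec \<Rightarrow> real) \<Rightarrow> bool" where
  "symplectic_form A \<omega> \<longleftrightarrow>
     smooth_2form A \<omega> \<and> closed_2form A \<omega> \<and>
     (\<forall>x. \<forall>v\<in>tangent_space A x. (\<forall>w\<in>tangent_space A x. \<omega> x v w = 0) \<longrightarrow> v = 0)"

definition almost_complex_structure ::
  "('a::topological_space, 'e::euclidean_space) chart set \<Rightarrow> ('a \<Rightarrow> 'a tvec \<Rightarrow> 'a tvec) \<Rightarrow> bool" where
  "almost_complex_structure A J \<longleftrightarrow>
     (\<forall>x. linear_on_subspace (tangent_space A x) (J x)) \<and>
     (\<forall>x. \<forall>v\<in>tangent_space A x. J x v \<in> tangent_space A x \<and> J x (J x v) = - v) \<and>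
     (\<forall>S V. open S \<and> vector_field A S V \<longrightarrow> vector_field A S (\<lambda>x. J x (V x)))"

definition gromov_manifold ::
  "nat \<Rightarrow> ('a::{t2_space, second_countable_topology}, 'e::euclidean_space) chart set \<Rightarrow>
     ('a \<Rightarrow> 'a tvec \<Rightarrow> 'a tvec \<Rightarrow> real) \<Rightarrow> ('a \<Rightarrow> 'a tvec \<Rightarrow> 'a tvec) \<Rightarrow> bool" where
  "gromov_manifold n A \<omega> J \<longleftrightarrow>
     DIM('e) = 2 * n \<and> smooth_atlas A \<and> symplectic_form A \<omega> \<and> almost_complex_structure A J \<and>
     (\<forall>x. \<forall>v\<in>tangent_space A x. \<forall>w\<in>tangent_space A x. \<omega> x v w = \<omega> x (J x v) (J x w)) \<and>
     (\<forall>x. \<forall>v\<in>tangent_space A x. v \<noteq> 0 \<longrightarrow> \<omega> x (J x v) v > 0)"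

definition gromov_metric ::
  "('a \<Rightarrow> 'a tvec \<Rightarrow> 'a tvec \<Rightarrow> real) \<Rightarrow> ('a \<Rightarrow> 'a tvec \<Rightarrow> 'a tvec) \<Rightarrow>
     'a \<Rightarrow> 'a tvec \<Rightarrow> 'a tvec \<Rightarrow> real" where
  "gromov_metric \<omega> J x v w = \<omega> x (J x v) w"

section \<open>The Levi-Civita connection and the Hessian\<close>

text \<open>
  \<open>nabla x v W\<close> is the covariant derivative of the vector field \<open>W\<close>, defined near \<open>x\<close>,
  in the direction of the tangent vector \<open>v\<close> at \<open>x\<close>.
\<close>

definition affine_connection ::
  "('a::topological_space, 'e::euclidean_space) chart set \<Rightarrow>
     ('a \<Rightarrow> 'a tvec \<Rightarrow> ('a \<Rightarrow> 'a tvec) \<Rightarrow> 'a tvec) \<Rightarrow> bool" where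
  "affine_connection A nabla \<longleftrightarrow>
     (\<forall>x v W. v \<in> tangent_space A x \<and> vector_field_near A x W \<longrightarrow> nabla x v W \<in> tangent_space A x) \<and>
     (\<forall>x v W Z. v \<in> tangent_space A x \<and> vector_field_near A x W \<and> vector_field_near A x Z \<and>
        (\<forall>\<^sub>F y in nhds x. W y = Z y) \<longrightarrow> nabla x v W = nabla x v Z) \<and>
     (\<forall>x W. vector_field_near A x W \<longrightarrow> linear_on_subspace (tangent_space A x) (\<lambda>v. nabla x v W)) \<and>
     (\<forall>x v W Z. v \<in> tangent_space A x \<and> vector_field_near A x W \<and> vector_field_near A x Z \<longrightarrow>
        nabla x v (\<lambda>y. W y + Z y) = nabla x v W + nabla x v Z) \<and>
     (\<forall>x v f W. v \<in> tangent_space A x \<and> smooth_near A x f \<and> vector_field_near A x W \<longrightarrow>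
        nabla x v (\<lambda>y. f y *\<^sub>R W y) = v f *\<^sub>R W x + f x *\<^sub>R nabla x v W) \<and>
     (\<forall>S V W. open S \<and> vector_field A S V \<and> vector_field A S W \<longrightarrow>
        vector_field A S (\<lambda>x. nabla x (V x) W))"

definition levi_civita_connection ::
  "('a::topological_space, 'e::euclidean_space) chart set \<Rightarrow> ('a \<Rightarrow> 'a tvec \<Rightarrow> 'a tvec \<Rightarrow> real) \<Rightarrow>
     ('a \<Rightarrow> 'a tvec \<Rightarrow> ('a \<Rightarrow> 'a tvec) \<Rightarrow> 'a tvec) \<Rightarrow> bool" where
  "levi_civita_connection A g nabla \<longleftrightarrow>
     affine_connection A nabla \<and>
     (\<forall>x V W. vector_field_near A x V \<and> vector_field_near A x W \<longrightarrow>
        nabla x (V x) W - nabla x (W x) V = lie_bracket A V W x) \<and>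
     (\<forall>x v W Z. v \<in> tangent_space A x \<and> vector_field_near A x W \<and> vector_field_near A x Z \<longrightarrow>
        v (\<lambda>y. g y (W y) (Z y)) = g x (nabla x v W) (Z x) + g x (W x) (nabla x v Z))"

definition hessian_fields ::
  "('a \<Rightarrow> 'a tvec \<Rightarrow> ('a \<Rightarrow> 'a tvec) \<Rightarrow> 'a tvec) \<Rightarrow> ('a \<Rightarrow> real) \<Rightarrow>
     ('a \<Rightarrow> 'a tvec) \<Rightarrow> ('a \<Rightarrow> 'a tvec) \<Rightarrow> 'a \<Rightarrow> real" where
  "hessian_fields nabla f V W x = V x (\<lambda>y. W y f) - nabla x (V x) W f"

text \<open>
  For \<open>f\<close> smooth near \<open>x\<close>, the value of \<^const>\<open>hessian_fields\<close> at \<open>x\<close> depends only on the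
  values of the two vector fields at \<open>x\<close>.
\<close>

definition hessian ::
  "('a::topological_space, 'e::euclidean_space) chart set \<Rightarrow>
     ('a \<Rightarrow> 'a tvec \<Rightarrow> ('a \<Rightarrow> 'a tvec) \<Rightarrow> 'a tvec) \<Rightarrow> ('a \<Rightarrow> real) \<Rightarrow>
     'a \<Rightarrow> 'a tvec \<Rightarrow> 'a tvec \<Rightarrow> real" where
  "hessian A nabla f x v w =
     (THE h. \<forall>V W. vector_field_near A x V \<and> vector_field_near A x W \<and> V x = v \<and> W x = w \<longrightarrow>
        hessian_fields nabla f V W x = h)"

definition orthonormal_basis ::
  "('v::real_vector \<Rightarrow> 'v \<Rightarrow> real) \<Rightarrow> 'v set \<Rightarrow> 'v set \<Rightarrow> bool" where
  "orthonormal_basis g W E \<longleftrightarrow>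
     finite E \<and> span E = W \<and> (\<forall>e\<in>E. \<forall>e'\<in>E. g e e' = (if e = e' then 1 else 0))"

text \<open>The trace over \<open>W\<close> of a bilinear form, as the common value over all orthonormal bases.\<close>

definition trace_on ::
  "('v::real_vector \<Rightarrow> 'v \<Rightarrow> real) \<Rightarrow> 'v set \<Rightarrow> ('v \<Rightarrow> 'v \<Rightarrow> real) \<Rightarrow> real" where
  "trace_on g W B = (THE t. \<forall>E. orthonormal_basis g W E \<longrightarrow> (\<Sum>e\<in>E. B e e) = t)"

definition laplace_beltrami ::
  "('a::topological_space, 'e::euclidean_space) chart set \<Rightarrow> ('a \<Rightarrow> 'a tvec \<Rightarrow> 'a tvec \<Rightarrow> real) \<Rightarrow>
     ('a \<Rightarrow> 'a tvec \<Rightarrow> ('a \<Rightarrow> 'a tvec) \<Rightarrow> 'a tvec) \<Rightarrow> ('a \<Rightarrow> real) \<Rightarrow> 'a \<Rightarrow> real" where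
  "laplace_beltrami A g nabla f x = trace_on (g x) (tangent_space A x) (hessian A nabla f x)"

section \<open>Plurisubharmonic and subharmonic functions\<close>

definition upper_semicontinuous :: "('a::topological_space \<Rightarrow> ereal) \<Rightarrow> bool" where
  "upper_semicontinuous u \<longleftrightarrow> (\<forall>x. u x < \<infinity>) \<and> (\<forall>a. open {x. u x < a})"

definition test_function ::
  "('a::topological_space, 'e::euclidean_space) chart set \<Rightarrow> ('a \<Rightarrow> ereal) \<Rightarrow> 'a \<Rightarrow> ('a \<Rightarrow> real) \<Rightarrow> bool" where
  "test_function A u x \<phi> \<longleftrightarrow>
     smooth_near A x \<phi> \<and> (\<forall>\<^sub>F y in nhds x. u y \<le> ereal (\<phi> y)) \<and> u x = ereal (\<phi> x)"

definition lagrangian_plane ::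
  "nat \<Rightarrow> ('a::topological_space, 'e::euclidean_space) chart set \<Rightarrow>
     ('a \<Rightarrow> 'a tvec \<Rightarrow> 'a tvec \<Rightarrow> real) \<Rightarrow> 'a \<Rightarrow> 'a tvec set \<Rightarrow> bool" where
  "lagrangian_plane n A \<omega> x W \<longleftrightarrow>
     W \<subseteq> tangent_space A x \<and> subspace W \<and> dim W = n \<and> (\<forall>v\<in>W. \<forall>w\<in>W. \<omega> x v w = 0)"

definition lagrangian_psh ::
  "nat \<Rightarrow> ('a::topological_space, 'e::euclidean_space) chart set \<Rightarrow>
     ('a \<Rightarrow> 'a tvec \<Rightarrow> 'a tvec \<Rightarrow> real) \<Rightarrow> ('a \<Rightarrow> 'a tvec \<Rightarrow> 'a tvec) \<Rightarrow>
     ('a \<Rightarrow> 'a tvec \<Rightarrow> ('a \<Rightarrow> 'a tvec) \<Rightarrow> 'a tvec) \<Rightarrow> ('a \<Rightarrow> ereal) \<Rightarrow> bool" where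
  "lagrangian_psh n A \<omega> J nabla u \<longleftrightarrow>
     upper_semicontinuous u \<and>
     (\<forall>x \<phi> W. test_function A u x \<phi> \<and> lagrangian_plane n A \<omega> x W \<longrightarrow>
        trace_on (gromov_metric \<omega> J x) W (hessian A nabla \<phi> x) \<ge> 0)"

definition subharmonic ::
  "('a::topological_space, 'e::euclidean_space) chart set \<Rightarrow> ('a \<Rightarrow> 'a tvec \<Rightarrow> 'a tvec \<Rightarrow> real) \<Rightarrow>
     ('a \<Rightarrow> 'a tvec \<Rightarrow> ('a \<Rightarrow> 'a tvec) \<Rightarrow> 'a tvec) \<Rightarrow> ('a \<Rightarrow> ereal) \<Rightarrow> bool" where
  "subharmonic A g nabla u \<longleftrightarrow>
     upper_semicontinuous u \<and>
     (\<forall>x \<phi>. test_function A u x \<phi> \<longrightarrow> laplace_beltrami A g nabla \<phi> x \<ge> 0)"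

end

theory Submission
  imports Defs
begin

text \<open>
  At each point a maximal set \<open>E\<close> that is orthonormal and isotropic spans a Lagrangian plane \<open>W\<close>,
  and \<open>E \<union> J E\<close> is an orthonormal basis of the tangent space: a vector orthogonal to \<open>E\<close> and \<open>J E\<close>
  could be used to enlarge \<open>E\<close>. As \<open>J W\<close> is Lagrangian too, the Laplacian of a test function is the
  sum of the traces of its Hessian over the two Lagrangian planes \<open>W\<close> and \<open>J W\<close>. Splitting the trace
  requires that the Hessian be a well-defined bilinear form, which follows from its symmetry.
\<close>

section \<open>Smooth maps\<close>

lemma Ck_on_cong:
  assumes "open S" "\<And>x. x \<in> S \<Longrightarrow> f x = g x" "Ck_on k S f"
  shows "Ck_on k S g"
  using assms(2,3)
proof (induction k arbitrary: f g)
  case 0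
  then show ?case by (simp cong: continuous_on_cong)
next
  case (Suc k)
  have d: "(g has_derivative frechet_derivative f (at x)) (at x)" if "x \<in> S" for x
  proof (rule has_derivative_transform_within_open[OF _ \<open>open S\<close> that])
    show "(f has_derivative frechet_derivative f (at x)) (at x)"
      using Suc.prems(2) that by (simp add: frechet_derivative_works[symmetric])
  qed (use Suc.prems(1) in simp)
  show ?case
  proof (simp, intro conjI ballI allI)
    fix x assume "x \<in> S"
    then show "g differentiable at x"
      using d differentiableI by blast
  next
    fix v
    show "Ck_on k S (\<lambda>x. frechet_derivative g (at x) v)"
    proof (rule Suc.IH)
      show "Ck_on k S (\<lambda>x. frechet_derivative f (at x) v)"
        using Suc.prems(2) by simp
      show "frechet_derivative f (at x) v = frechet_derivative g (at x) v" if "x \<in> S" for x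
        using frechet_derivative_at[OF d[OF that]] by simp
    qed
  qed
qed

lemma Ck_on_subset: "Ck_on k S f \<Longrightarrow> T \<subseteq> S \<Longrightarrow> Ck_on k T f"
  by (induction k arbitrary: f) (auto intro: continuous_on_subset)

lemma Ck_on_SucI:
  assumes "open S" "\<And>x. x \<in> S \<Longrightarrow> (f has_derivative f' x) (at x)"
    and "\<And>v. Ck_on k S (\<lambda>x. f' x v)"
  shows "Ck_on (Suc k) S f"
proof (simp, intro conjI ballI allI)
  fix x assume "x \<in> S"
  then show "f differentiable at x"
    using assms(2) differentiableI by blast
next
  fix v
  show "Ck_on k S (\<lambda>x. frechet_derivative f (at x) v)"
    by (rule Ck_on_cong[OF assms(1) _ assms(3)[of v]])
      (use frechet_derivative_at[OF assms(2)] in simp)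
qed

lemma Ck_on_Suc_has_derivative:
  assumes "Ck_on (Suc k) S f" "x \<in> S"
  shows "(f has_derivative frechet_derivative f (at x)) (at x)"
  using assms by (simp add: frechet_derivative_works[symmetric])

lemma Ck_on_Suc_imp: "Ck_on (Suc k) S f \<Longrightarrow> Ck_on k S f"
proof (induction k arbitrary: f)
  case 0
  then show ?case
    by (auto intro!: continuous_at_imp_continuous_on differentiable_imp_continuous_within)
next
  case (Suc k)
  then show ?case
    by (metis Ck_on.simps(2))
qed

lemma Ck_on_const: "open S \<Longrightarrow> Ck_on k S (\<lambda>x. c)"
  by (induction k arbitrary: c)
    (auto intro!: Ck_on_SucI[where f' = "\<lambda>x v. 0"] simp del: Ck_on.simps(2))

lemma Ck_on_add:
  assumes "open S" "Ck_on k S f" "Ck_on k S g"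
  shows "Ck_on k S (\<lambda>x. f x + g x)"
  using assms(2,3)
proof (induction k arbitrary: f g)
  case 0
  then show ?case by (simp add: continuous_on_add)
next
  case (Suc k)
  show ?case
    by (rule Ck_on_SucI[OF assms(1) has_derivative_add[OF
          Ck_on_Suc_has_derivative[OF Suc.prems(1)] Ck_on_Suc_has_derivative[OF Suc.prems(2)]]])
      (use Suc in auto)
qed

lemma Ck_on_sum:
  assumes "open S" "\<And>i. i \<in> I \<Longrightarrow> Ck_on k S (f i)"
  shows "Ck_on k S (\<lambda>x. \<Sum>i\<in>I. f i x)"
  using assms(2)
  by (induction I rule: infinite_finite_induct)
    (auto intro: Ck_on_const Ck_on_add \<open>open S\<close>)

lemma Ck_on_bounded_linear:
  assumes "open S" "bounded_linear L" "Ck_on k S f"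
  shows "Ck_on k S (\<lambda>x. L (f x))"
  using assms(3)
proof (induction k arbitrary: f)
  case 0
  then show ?case by (simp add: bounded_linear.continuous_on[OF assms(2)])
next
  case (Suc k)
  show ?case
    by (rule Ck_on_SucI[OF assms(1) bounded_linear.has_derivative[OF assms(2)
          Ck_on_Suc_has_derivative[OF Suc.prems]]])
      (use Suc in auto)
qed

lemma Ck_on_scaleR:
  fixes f :: "'e::real_normed_vector \<Rightarrow> real"
  assumes "open S" "Ck_on k S f" "Ck_on k S g"
  shows "Ck_on k S (\<lambda>x. f x *\<^sub>R g x)"
  using assms(2,3)
proof (induction k arbitrary: f g)
  case 0
  then show ?case by (simp add: continuous_on_scaleR)
next
  case (Suc k)
  show ?case
  proof (rule Ck_on_SucI[OF assms(1) has_derivative_scaleR[OF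
          Ck_on_Suc_has_derivative[OF Suc.prems(1)] Ck_on_Suc_has_derivative[OF Suc.prems(2)]]])
    fix v
    show "Ck_on k S (\<lambda>x. f x *\<^sub>R frechet_derivative g (at x) v +
        frechet_derivative f (at x) v *\<^sub>R g x)"
      using Suc.prems Ck_on_Suc_imp[OF Suc.prems(1)] Ck_on_Suc_imp[OF Suc.prems(2)]
      by (intro Ck_on_add[OF assms(1)] Suc.IH) auto
  qed
qed

lemma Ck_on_compose:
  fixes g :: "'f::euclidean_space \<Rightarrow> 'g::real_normed_vector"
    and h :: "'e::real_normed_vector \<Rightarrow> 'f"
  assumes "open S" "h ` S \<subseteq> T" "Ck_on k S h" "Ck_on k T g"
  shows "Ck_on k S (g \<circ> h)"
  using assms(3,4)
proof (induction k arbitrary: g)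
  case 0
  then show ?case
    using assms(2) by (auto intro: continuous_on_compose2)
next
  case (Suc k)
  let ?D = "\<lambda>x v. \<Sum>b\<in>Basis. (frechet_derivative h (at x) v \<bullet> b) *\<^sub>R
    ((\<lambda>y. frechet_derivative g (at y) b) \<circ> h) x"
  show ?case
  proof (rule Ck_on_SucI[OF assms(1)])
    fix x assume x: "x \<in> S"
    have g: "(g has_derivative frechet_derivative g (at (h x))) (at (h x))"
      using Ck_on_Suc_has_derivative[OF Suc.prems(2)] x assms(2) by auto
    have lin: "frechet_derivative g (at (h x)) w = (\<Sum>b\<in>Basis. (w \<bullet> b) *\<^sub>R frechet_derivative g (at (h x)) b)"
      for w
    proof -
      have "linear (frechet_derivative g (at (h x)))"
        using g has_derivative_linear by blast
      from linear_sum[OF this, of "\<lambda>b. (w \<bullet> b) *\<^sub>R b" Basis] show ?thesis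
        by (simp add: euclidean_representation linear_cmul[OF \<open>linear _\<close>])
    qed
    have "frechet_derivative g (at (h x)) \<circ> frechet_derivative h (at x) = ?D x"
      unfolding comp_def by (rule ext lin)+
    then show "((g \<circ> h) has_derivative ?D x) (at x)"
      using diff_chain_at[OF Ck_on_Suc_has_derivative[OF Suc.prems(1) x] g] by simp
  next
    fix v
    show "Ck_on k S (\<lambda>x. ?D x v)"
    proof (intro Ck_on_sum[OF assms(1)] Ck_on_scaleR[OF assms(1)])
      fix b :: 'f assume "b \<in> Basis"
      show "Ck_on k S (\<lambda>x. frechet_derivative h (at x) v \<bullet> b)"
        using Suc.prems(1) by (intro Ck_on_bounded_linear[OF assms(1) bounded_linear_inner_left]) auto
      show "Ck_on k S ((\<lambda>y. frechet_derivative g (at y) b) \<circ> h)"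
        using Suc.prems Ck_on_Suc_imp[OF Suc.prems(1)] by (intro Suc.IH) auto
    qed
  qed
qed

lemma smooth_on_cong:
  "open S \<Longrightarrow> (\<And>x. x \<in> S \<Longrightarrow> f x = g x) \<Longrightarrow> smooth_on S f \<Longrightarrow> smooth_on S g"
  unfolding smooth_on_def using Ck_on_cong by blast

lemma smooth_on_subset: "smooth_on S f \<Longrightarrow> T \<subseteq> S \<Longrightarrow> smooth_on T f"
  unfolding smooth_on_def using Ck_on_subset by blast

lemma smooth_on_compose:
  fixes g :: "'f::euclidean_space \<Rightarrow> 'g::real_normed_vector"
  assumes "open S" "h ` S \<subseteq> T" "smooth_on S h" "smooth_on T g"
  shows "smooth_on S (g \<circ> h)"
  using assms Ck_on_compose unfolding smooth_on_def by blast

lemma smooth_on_inner_left: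
  "open S \<Longrightarrow> smooth_on S f \<Longrightarrow> smooth_on S (\<lambda>x. f x \<bullet> b)"
  unfolding smooth_on_def using Ck_on_bounded_linear[OF _ bounded_linear_inner_left] by blast

lemma smooth_on_has_derivative:
  "smooth_on S f \<Longrightarrow> x \<in> S \<Longrightarrow> (f has_derivative frechet_derivative f (at x)) (at x)"
  unfolding smooth_on_def using Ck_on_Suc_has_derivative by blast

lemma smooth_on_frechet_derivative:
  "smooth_on S f \<Longrightarrow> smooth_on S (\<lambda>x. frechet_derivative f (at x) v)"
  unfolding smooth_on_def using Ck_on.simps(2) by blast

section \<open>Tangent spaces\<close>

lemma chart_image_open:
  assumes "is_chart (U, \<kappa>)" "open S"
  shows "open (\<kappa> ` (U \<inter> S))"
proof -
  have "openin (top_of_set (\<kappa> ` U)) (\<kappa> ` (U \<inter> S))"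
    using assms unfolding is_chart_def
    by (auto intro!: homeomorphism_imp_open_map[where f = \<kappa> and S = U])
  then show ?thesis
    using assms(1) unfolding is_chart_def by (auto intro: openin_open_trans)
qed

lemma chart_inv: "is_chart (U, \<kappa>) \<Longrightarrow> x \<in> U \<Longrightarrow> inv_into U \<kappa> (\<kappa> x) = x"
  unfolding is_chart_def homeomorphism_def by auto

lemma atlas_is_chart: "smooth_atlas A \<Longrightarrow> c \<in> A \<Longrightarrow> is_chart c"
  unfolding smooth_atlas_def by blast

lemma atlas_transition:
  "smooth_atlas A \<Longrightarrow> (U, \<kappa>) \<in> A \<Longrightarrow> (V, \<mu>) \<in> A \<Longrightarrow>
    smooth_on (\<kappa> ` (U \<inter> V)) (\<mu> \<circ> inv_into U \<kappa>)"
  unfolding smooth_atlas_def by blast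

lemma atlas_chart_at:
  assumes "smooth_atlas A"
  obtains U \<kappa> where "(U, \<kappa>) \<in> A" "x \<in> U"
  using assms unfolding smooth_atlas_def by blast

lemma smooth_near_has_derivative:
  assumes "smooth_atlas A" "(U, \<kappa>) \<in> A" "x \<in> U" "smooth_near A x f"
  shows "(f \<circ> inv_into U \<kappa> has_derivative frechet_derivative (f \<circ> inv_into U \<kappa>) (at (\<kappa> x))) (at (\<kappa> x))"
proof -
  obtain S where S: "x \<in> S" "smooth_fun A S f"
    using assms(4) unfolding smooth_near_def by blast
  then have "smooth_on (\<kappa> ` (U \<inter> S)) (f \<circ> inv_into U \<kappa>)"
    using assms(2) unfolding smooth_fun_def by blast
  then show ?thesis
    by (rule smooth_on_has_derivative) (use S assms(3) in blast)
qed

lemma linear_coord_tvec: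
  assumes "smooth_atlas A" "(U, \<kappa>) \<in> A" "x \<in> U"
  shows "linear (coord_tvec A (U, \<kappa>) x)"
proof -
  have "linear (frechet_derivative (f \<circ> inv_into U \<kappa>) (at (\<kappa> x)))" if "smooth_near A x f" for f
    using smooth_near_has_derivative[OF assms that] has_derivative_linear by blast
  then show ?thesis
    by (intro linearI)
      (auto simp: coord_tvec_def fun_eq_iff scaleR_fun_def linear_add linear_cmul)
qed

lemma smooth_fun_coordinate:
  assumes "smooth_atlas A" "(U, \<kappa>) \<in> A"
  shows "smooth_fun A U (\<lambda>y. \<kappa> y \<bullet> b)"
  unfolding smooth_fun_def
proof clarify
  fix V \<mu> assume V: "(V, \<mu>) \<in> A"
  have "open (\<mu> ` (V \<inter> U))"
    using chart_image_open[OF atlas_is_chart[OF assms(1) V]] atlas_is_chart[OF assms]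
    by (simp add: is_chart_def)
  from smooth_on_inner_left[OF this atlas_transition[OF assms(1) V assms(2)], of b]
  show "smooth_on (\<mu> ` (V \<inter> U)) ((\<lambda>y. \<kappa> y \<bullet> b) \<circ> inv_into V \<mu>)"
    by (simp add: comp_def)
qed

lemma coord_tvec_coordinate:
  assumes "smooth_atlas A" "(U, \<kappa>) \<in> A" "x \<in> U"
  shows "coord_tvec A (U, \<kappa>) x \<xi> (\<lambda>y. \<kappa> y \<bullet> b) = \<xi> \<bullet> b"
proof -
  have c: "open U" "open (\<kappa> ` U)"
    using atlas_is_chart[OF assms(1,2)] by (auto simp: is_chart_def)
  have s: "smooth_near A x (\<lambda>y. \<kappa> y \<bullet> b)"
    unfolding smooth_near_def using smooth_fun_coordinate[OF assms(1,2)] c assms(3) by blast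
  have "((\<lambda>y. \<kappa> y \<bullet> b) \<circ> inv_into U \<kappa> has_derivative (\<lambda>z. z \<bullet> b)) (at (\<kappa> x))"
  proof (rule has_derivative_transform_within_open)
    show "((\<lambda>z. z \<bullet> b) has_derivative (\<lambda>z. z \<bullet> b)) (at (\<kappa> x))"
      by (rule bounded_linear_imp_has_derivative[OF bounded_linear_inner_left])
    show "open (\<kappa> ` U)" "\<kappa> x \<in> \<kappa> ` U"
      using c assms(3) by auto
    show "z \<bullet> b = ((\<lambda>y. \<kappa> y \<bullet> b) \<circ> inv_into U \<kappa>) z" if "z \<in> \<kappa> ` U" for z
      using that by (simp add: f_inv_into_f)
  qed
  from frechet_derivative_at[OF this] show ?thesis
    using s by (simp add: coord_tvec_def) metis
qed

lemma inj_coord_tvec: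
  assumes "smooth_atlas A" "(U, \<kappa>) \<in> A" "x \<in> U"
  shows "inj (coord_tvec A (U, \<kappa>) x)"
  by (rule injI, rule euclidean_eqI) (metis coord_tvec_coordinate[OF assms])

lemma coord_tvec_change:
  fixes A :: "('a::topological_space, 'e::euclidean_space) chart set"
  assumes "smooth_atlas A" "(U, \<kappa>) \<in> A" "x \<in> U" "(V, \<mu>) \<in> A" "x \<in> V"
  shows "coord_tvec A (V, \<mu>) x \<xi> =
    coord_tvec A (U, \<kappa>) x (frechet_derivative (\<kappa> \<circ> inv_into V \<mu>) (at (\<mu> x)) \<xi>)"
proof
  fix f :: "'a \<Rightarrow> real"
  let ?h = "\<kappa> \<circ> inv_into V \<mu>" and ?g = "f \<circ> inv_into U \<kappa>"
  have cV: "is_chart (V, \<mu>)" and cU: "is_chart (U, \<kappa>)"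
    using assms atlas_is_chart by blast+
  have o: "open (\<mu> ` (V \<inter> U))"
    using chart_image_open[OF cV] cU by (simp add: is_chart_def)
  have x: "\<mu> x \<in> \<mu> ` (V \<inter> U)"
    using assms by blast
  show "coord_tvec A (V, \<mu>) x \<xi> f = coord_tvec A (U, \<kappa>) x (frechet_derivative ?h (at (\<mu> x)) \<xi>) f"
  proof (cases "smooth_near A x f")
    case True
    have h: "(?h has_derivative frechet_derivative ?h (at (\<mu> x))) (at (\<mu> x))"
      by (rule smooth_on_has_derivative[OF atlas_transition[OF assms(1,4,2)] x])
    have hx: "?h (\<mu> x) = \<kappa> x"
      using chart_inv[OF cV assms(5)] by simp
    have "(?g \<circ> ?h has_derivative
        (frechet_derivative ?g (at (\<kappa> x)) \<circ> frechet_derivative ?h (at (\<mu> x)))) (at (\<mu> x))"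
      using smooth_near_has_derivative[OF assms(1-3) True] diff_chain_at[OF h] hx by metis
    then have "(f \<circ> inv_into V \<mu> has_derivative
        (frechet_derivative ?g (at (\<kappa> x)) \<circ> frechet_derivative ?h (at (\<mu> x)))) (at (\<mu> x))"
      by (rule has_derivative_transform_within_open[OF _ o x])
        (auto simp: chart_inv[OF cV] chart_inv[OF cU])
    from frechet_derivative_at[OF this] True show ?thesis
      by (simp add: coord_tvec_def comp_def fun_eq_iff)
  qed (simp add: coord_tvec_def)
qed

lemma tangent_space_eq_range:
  assumes "smooth_atlas A" "(U, \<kappa>) \<in> A" "x \<in> U"
  shows "tangent_space A x = range (coord_tvec A (U, \<kappa>) x)"
  using coord_tvec_change[OF assms] assms(2,3) unfolding tangent_space_def by fast

lemma subspace_tangent_space: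
  assumes "smooth_atlas A"
  shows "subspace (tangent_space A x)"
  by (rule atlas_chart_at[OF assms, of x])
    (metis assms linear_coord_tvec linear_subspace_image subspace_UNIV tangent_space_eq_range)

lemma tangent_space_basis:
  fixes A :: "('a::topological_space, 'e::euclidean_space) chart set"
  assumes "smooth_atlas A"
  obtains D where "finite D" "independent D" "span D = tangent_space A x" "card D = DIM('e)"
proof -
  obtain U \<kappa> where c: "(U, \<kappa>) \<in> A" "x \<in> U"
    using atlas_chart_at[OF assms] by blast
  let ?c = "coord_tvec A (U, \<kappa>) x"
  have lin: "linear ?c" and inj: "inj ?c"
    using linear_coord_tvec inj_coord_tvec assms c by blast+
  show thesis
  proof
    show "finite (?c ` Basis)" by simp
    show "independent (?c ` Basis)"
      using linear_independent_injective_image[OF lin independent_Basis] inj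
      by (simp add: inj_on_subset)
    show "span (?c ` Basis) = tangent_space A x"
      by (simp add: linear_span_image[OF lin] tangent_space_eq_range[OF assms c])
    show "card (?c ` Basis) = DIM('e)"
      using inj by (simp add: card_image inj_on_subset)
  qed
qed

lemma vector_field_coord:
  assumes "smooth_atlas A" "(U, \<kappa>) \<in> A"
  shows "vector_field A U (\<lambda>y. coord_tvec A (U, \<kappa>) y \<xi>)"
  unfolding vector_field_def
proof (intro conjI ballI allI impI)
  fix x assume "x \<in> U"
  then show "coord_tvec A (U, \<kappa>) x \<xi> \<in> tangent_space A x"
    using tangent_space_eq_range[OF assms] by blast
next
  fix S f assume "open S \<and> S \<subseteq> U \<and> smooth_fun A S f"
  then have S: "open S" "S \<subseteq> U" "smooth_fun A S f" by auto
  let ?D = "\<lambda>z. frechet_derivative (f \<circ> inv_into U \<kappa>) (at z) \<xi>"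
  have D: "smooth_on (\<kappa> ` (U \<inter> S)) ?D"
    using S(3) assms(2) by (intro smooth_on_frechet_derivative) (auto simp: smooth_fun_def)
  show "smooth_fun A S (\<lambda>x. coord_tvec A (U, \<kappa>) x \<xi> f)"
    unfolding smooth_fun_def
  proof clarify
    fix V \<mu> assume V: "(V, \<mu>) \<in> A"
    have cV: "is_chart (V, \<mu>)"
      using assms V atlas_is_chart by blast
    have o: "open (\<mu> ` (V \<inter> S))"
      using chart_image_open[OF cV S(1)] .
    have "smooth_on (\<mu> ` (V \<inter> S)) (?D \<circ> (\<kappa> \<circ> inv_into V \<mu>))"
    proof (rule smooth_on_compose[OF o _ _ D])
      show "(\<kappa> \<circ> inv_into V \<mu>) ` \<mu> ` (V \<inter> S) \<subseteq> \<kappa> ` (U \<inter> S)"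
        using S(2) by (auto simp: chart_inv[OF cV])
      show "smooth_on (\<mu> ` (V \<inter> S)) (\<kappa> \<circ> inv_into V \<mu>)"
        using S(2) by (intro smooth_on_subset[OF atlas_transition[OF assms(1) V assms(2)]]) blast
    qed
    then show "smooth_on (\<mu> ` (V \<inter> S)) ((\<lambda>x. coord_tvec A (U, \<kappa>) x \<xi> f) \<circ> inv_into V \<mu>)"
    proof (rule smooth_on_cong[OF o, rotated])
      fix z assume "z \<in> \<mu> ` (V \<inter> S)"
      then obtain y where y: "y \<in> V" "y \<in> S" "z = \<mu> y" by blast
      have "smooth_near A y f"
        using S y unfolding smooth_near_def by blast
      then show "(?D \<circ> (\<kappa> \<circ> inv_into V \<mu>)) z = ((\<lambda>x. coord_tvec A (U, \<kappa>) x \<xi> f) \<circ> inv_into V \<mu>) z"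
        using y by (simp add: coord_tvec_def chart_inv[OF cV])
    qed
  qed
qed

lemma tangent_vector_extends:
  assumes "smooth_atlas A" "v \<in> tangent_space A x"
  obtains V where "vector_field_near A x V" "V x = v"
proof -
  obtain U \<kappa> \<xi> where c: "(U, \<kappa>) \<in> A" "x \<in> U" and v: "v = coord_tvec A (U, \<kappa>) x \<xi>"
    using assms(2) unfolding tangent_space_def by blast
  have "open U"
    using atlas_is_chart[OF assms(1) c(1)] by (simp add: is_chart_def)
  then have "vector_field_near A x (\<lambda>y. coord_tvec A (U, \<kappa>) y \<xi>)"
    unfolding vector_field_near_def using c vector_field_coord[OF assms(1)] by blast
  then show thesis
    using that v by blast
qed

section \<open>Orthonormal bases and traces\<close>

lemma linear_on_subspaceD:
  assumes "linear_on_subspace T L" "subspace T" "v \<in> T" "w \<in> T"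
  shows "L (v + w) = L v + L w" "L (r *\<^sub>R v) = r *\<^sub>R L v" "L 0 = 0"
proof -
  have L: "\<And>a b v w. v \<in> T \<Longrightarrow> w \<in> T \<Longrightarrow> L (a *\<^sub>R v + b *\<^sub>R w) = a *\<^sub>R L v + b *\<^sub>R L w"
    using assms(1) unfolding linear_on_subspace_def by blast
  show "L (v + w) = L v + L w" "L (r *\<^sub>R v) = r *\<^sub>R L v" "L 0 = 0"
    using L[OF assms(3,4), of 1 1] L[OF assms(3,4), of r 0] L[OF assms(3,4), of 0 0] by simp_all
qed

lemma linear_on_subspace_sum:
  assumes "linear_on_subspace T L" "subspace T" "\<And>i. i \<in> I \<Longrightarrow> v i \<in> T"
  shows "L (\<Sum>i\<in>I. c i *\<^sub>R v i) = (\<Sum>i\<in>I. c i *\<^sub>R L (v i))"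
  using assms(3)
proof (induction I rule: infinite_finite_induct)
  case (insert i I)
  have "(\<Sum>i\<in>I. c i *\<^sub>R v i) \<in> T"
    using insert.prems by (intro subspace_sum[OF assms(2)] subspace_scale[OF assms(2)]) simp
  then show ?case
    using insert linear_on_subspaceD(1,2)[OF assms(1,2)] subspace_scale[OF assms(2)] by simp
qed (use linear_on_subspaceD(3)[OF assms(1,2)] subspace_0[OF assms(2)] in auto)

lemma linear_on_subspace_mono:
  "linear_on_subspace T L \<Longrightarrow> S \<subseteq> T \<Longrightarrow> linear_on_subspace S L"
  unfolding linear_on_subspace_def by blast

locale inner_on =
  fixes T :: "'v::real_vector set" and g :: "'v \<Rightarrow> 'v \<Rightarrow> real"
  assumes subspace_T: "subspace T"
    and linear_left: "w \<in> T \<Longrightarrow> linear_on_subspace T (\<lambda>v. g v w)"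
    and commute: "v \<in> T \<Longrightarrow> w \<in> T \<Longrightarrow> g v w = g w v"
    and positive: "v \<in> T \<Longrightarrow> v \<noteq> 0 \<Longrightarrow> g v v > 0"
begin

definition orthonormal :: "'v set \<Rightarrow> bool" where
  "orthonormal E \<longleftrightarrow> finite E \<and> E \<subseteq> T \<and> (\<forall>e\<in>E. \<forall>e'\<in>E. g e e' = (if e = e' then 1 else 0))"

lemma inner_sum_left:
  assumes "orthonormal E" "f \<in> E"
  shows "g (\<Sum>e\<in>E. c e *\<^sub>R e) f = c f"
proof -
  have "g (\<Sum>e\<in>E. c e *\<^sub>R e) f = (\<Sum>e\<in>E. c e * g e f)"
    using assms linear_on_subspace_sum[OF linear_left[of f] subspace_T, of E "\<lambda>e. e" c]
    unfolding orthonormal_def by auto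
  also have "\<dots> = (\<Sum>e\<in>E. if e = f then c e else 0)"
    using assms unfolding orthonormal_def by (intro sum.cong) auto
  finally show ?thesis
    using assms unfolding orthonormal_def by simp
qed

lemma orthonormal_expansion:
  assumes "orthonormal E" "v \<in> span E"
  shows "v = (\<Sum>e\<in>E. g v e *\<^sub>R e)"
proof -
  obtain c where v: "v = (\<Sum>e\<in>E. c e *\<^sub>R e)"
    using assms span_finite[of E] unfolding orthonormal_def by auto
  then have "g v e = c e" if "e \<in> E" for e
    using inner_sum_left[OF assms(1) that] by simp
  then show ?thesis
    using v by simp
qed

lemma linear_orthonormal_expansion:
  assumes "orthonormal E" "v \<in> span E" "linear_on_subspace W L" "subspace W" "E \<subseteq> W"
  shows "L v = (\<Sum>e\<in>E. g v e *\<^sub>R L e)"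
proof -
  have "L v = L (\<Sum>e\<in>E. g v e *\<^sub>R e)"
    by (rule arg_cong[OF orthonormal_expansion[OF assms(1,2)]])
  also have "\<dots> = (\<Sum>e\<in>E. g v e *\<^sub>R L e)"
    using assms(5) by (intro linear_on_subspace_sum[OF assms(3,4)]) blast
  finally show ?thesis .
qed

lemma orthonormal_independent:
  assumes "orthonormal E"
  shows "independent E"
proof (rule independent_if_scalars_zero)
  show "finite E"
    using assms by (simp add: orthonormal_def)
  fix c e assume "(\<Sum>e\<in>E. c e *\<^sub>R e) = 0" and e: "e \<in> E"
  then have "c e = g 0 e"
    using inner_sum_left[OF assms e, of c] by simp
  also have "\<dots> = 0"
    using linear_on_subspaceD(3)[OF linear_left subspace_T subspace_0 subspace_0] e assms subspace_T
    unfolding orthonormal_def by auto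
  finally show "c e = 0" .
qed

lemma trace_basis_independent:
  assumes E: "orthonormal E" "span E = W" and F: "orthonormal F" "span F = W"
    and B: "\<And>w. w \<in> W \<Longrightarrow> linear_on_subspace W (\<lambda>v. B v w)"
      "\<And>v. v \<in> W \<Longrightarrow> linear_on_subspace W (B v)"
  shows "(\<Sum>e\<in>E. B e e) = (\<Sum>f\<in>F. (B f f :: real))"
proof -
  have W: "subspace W" "E \<subseteq> W" "F \<subseteq> W"
    using E(2) F(2) span_superset by auto
  have Be: "B e e = (\<Sum>f\<in>F. \<Sum>f'\<in>F. g e f * g e f' * B f f')" if "e \<in> E" for e
  proof -
    have e: "e \<in> W" "e \<in> span F"
      using that W F(2) by auto
    have "B e w = (\<Sum>f\<in>F. g e f * B f w)" if "w \<in> W" for w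
      using linear_orthonormal_expansion[OF F(1) e(2) B(1)[OF that] W(1,3)] by simp
    moreover have "B f e = (\<Sum>f'\<in>F. g e f' * B f f')" if "f \<in> F" for f
      using linear_orthonormal_expansion[OF F(1) e(2) B(2)[of f] W(1,3)] that W(3) by auto
    ultimately show ?thesis
      using e(1) W(3) by (simp add: sum_distrib_left mult.assoc subset_iff)
  qed
  have gf: "(\<Sum>e\<in>E. g e f * g e f') = g f f'" if "f \<in> F" "f' \<in> F" for f f'
  proof -
    have T: "f \<in> T" "f' \<in> T" "E \<subseteq> T" "f \<in> span E"
      using E F(1) that W(3) unfolding orthonormal_def by auto
    have "g f f' = (\<Sum>e\<in>E. g f e * g e f')"
      using linear_orthonormal_expansion[OF E(1) T(4) linear_left[OF T(2)] subspace_T T(3)] by simp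
    then show ?thesis
      using commute[of f] T by (simp add: subset_iff)
  qed
  have "(\<Sum>e\<in>E. B e e) = (\<Sum>e\<in>E. \<Sum>f\<in>F. \<Sum>f'\<in>F. g e f * g e f' * B f f')"
    by (simp add: Be)
  also have "\<dots> = (\<Sum>f\<in>F. \<Sum>e\<in>E. \<Sum>f'\<in>F. g e f * g e f' * B f f')"
    by (rule sum.swap)
  also have "\<dots> = (\<Sum>f\<in>F. \<Sum>f'\<in>F. \<Sum>e\<in>E. g e f * g e f' * B f f')"
    by (intro sum.cong refl sum.swap)
  also have "\<dots> = (\<Sum>f\<in>F. \<Sum>f'\<in>F. g f f' * B f f')"
    by (simp add: gf flip: sum_distrib_right)
  also have "\<dots> = (\<Sum>f\<in>F. \<Sum>f'\<in>F. if f = f' then B f f' else 0)"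
    using F(1) unfolding orthonormal_def by (intro sum.cong) auto
  also have "\<dots> = (\<Sum>f\<in>F. B f f)"
    using F(1) unfolding orthonormal_def by simp
  finally show ?thesis .
qed

lemma trace_on_eq_sum:
  assumes "orthonormal E" "span E = W"
    and "\<And>w. w \<in> T \<Longrightarrow> linear_on_subspace T (\<lambda>v. B v w)"
    and "\<And>v. v \<in> T \<Longrightarrow> linear_on_subspace T (B v)"
  shows "trace_on g W B = (\<Sum>e\<in>E. B e e)"
proof -
  have WT: "W \<subseteq> T"
    using assms(1,2) span_minimal[OF _ subspace_T] unfolding orthonormal_def by blast
  have B: "\<And>w. w \<in> W \<Longrightarrow> linear_on_subspace W (\<lambda>v. B v w)"
    "\<And>v. v \<in> W \<Longrightarrow> linear_on_subspace W (B v)"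
    using assms(3,4) WT linear_on_subspace_mono by blast+
  show ?thesis
    unfolding trace_on_def
  proof (rule the_equality)
    show "\<forall>F. orthonormal_basis g W F \<longrightarrow> (\<Sum>e\<in>F. B e e) = (\<Sum>e\<in>E. B e e)"
    proof (intro allI impI)
      fix F assume "orthonormal_basis g W F"
      then have "orthonormal F" "span F = W"
        using WT span_superset[of F] unfolding orthonormal_basis_def orthonormal_def by auto
      from trace_basis_independent[OF this assms(1,2) B]
      show "(\<Sum>e\<in>F. B e e) = (\<Sum>e\<in>E. B e e)" .
    qed
    show "t = (\<Sum>e\<in>E. B e e)"
      if "\<forall>F. orthonormal_basis g W F \<longrightarrow> (\<Sum>e\<in>F. B e e) = t" for t
      using that assms(1,2) unfolding orthonormal_basis_def orthonormal_def by auto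
  qed
qed

lemma orthonormal_extend:
  assumes "orthonormal E" "v \<in> T" "v \<notin> span E"
  obtains w where "w \<in> T" "g w w = 1" "\<And>e. e \<in> E \<Longrightarrow> g w e = 0"
proof -
  define p where "p = (\<Sum>e\<in>E. g v e *\<^sub>R e)"
  have E: "E \<subseteq> T"
    using assms(1) by (simp add: orthonormal_def)
  have pE: "p \<in> span E"
    unfolding p_def by (intro span_sum span_scale span_base)
  have p: "p \<in> T"
    using pE span_minimal[OF E subspace_T] by blast
  define q where "q = v - p"
  have q: "q \<in> T" "q \<noteq> 0" "q = 1 *\<^sub>R v + (- 1) *\<^sub>R p"
    using p pE assms(2,3) subspace_diff[OF subspace_T] by (auto simp: q_def)
  have qe: "g q e = 0" if "e \<in> E" for e
  proof -
    have "g q e = g v e - g p e"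
      using linear_on_subspaceD(1)[OF linear_left subspace_T p q(1), of e]
        that E by (simp add: q_def subset_iff)
    then show ?thesis
      using inner_sum_left[OF assms(1) that, of "g v"] by (simp add: p_def)
  qed
  define s where "s = 1 / sqrt (g q q)"
  have s: "s * s * g q q = 1"
    using positive[OF q(1,2)] by (simp add: s_def)
  have lin: "g (s *\<^sub>R q) w = s * g q w" if "w \<in> T" for w
    using linear_on_subspaceD(2)[OF linear_left[OF that] subspace_T q(1) q(1)] by simp
  show thesis
  proof
    show sq: "s *\<^sub>R q \<in> T"
      using q(1) subspace_T by (simp add: subspace_scale)
    show "g (s *\<^sub>R q) (s *\<^sub>R q) = 1"
      using lin[OF sq] lin[OF q(1)] commute[OF q(1) sq] s by simp
    show "g (s *\<^sub>R q) e = 0" if "e \<in> E" for e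
      using lin qe that E by auto
  qed
qed

end

section \<open>Unitary bases\<close>

locale hermitian_on =
  fixes T :: "'v::real_vector set" and \<omega> :: "'v \<Rightarrow> 'v \<Rightarrow> real" and J :: "'v \<Rightarrow> 'v"
  assumes subspace_T: "subspace T"
    and form_left: "w \<in> T \<Longrightarrow> linear_on_subspace T (\<lambda>v. \<omega> v w)"
    and form_right: "v \<in> T \<Longrightarrow> linear_on_subspace T (\<omega> v)"
    and alternating: "v \<in> T \<Longrightarrow> \<omega> v v = 0"
    and J_linear: "linear_on_subspace T J"
    and J_in: "v \<in> T \<Longrightarrow> J v \<in> T"
    and J_J: "v \<in> T \<Longrightarrow> J (J v) = - v"
    and compatible: "v \<in> T \<Longrightarrow> w \<in> T \<Longrightarrow> \<omega> (J v) (J w) = \<omega> v w"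
    and tamed: "v \<in> T \<Longrightarrow> v \<noteq> 0 \<Longrightarrow> \<omega> (J v) v > 0"
begin

lemma form_minus:
  assumes "v \<in> T" "w \<in> T"
  shows "\<omega> (- v) w = - \<omega> v w"
  using linear_on_subspaceD(2)[OF form_left[OF assms(2)] subspace_T assms(1,1), of "- 1"] by simp

lemma skew:
  assumes "v \<in> T" "w \<in> T"
  shows "\<omega> v w = - \<omega> w v"
proof -
  have vw: "v + w \<in> T"
    using assms by (rule subspace_add[OF subspace_T])
  have "\<omega> (v + w) (v + w) = \<omega> v v + \<omega> v w + (\<omega> w v + \<omega> w w)"
    using linear_on_subspaceD(1)[OF form_left[OF vw] subspace_T assms]
      linear_on_subspaceD(1)[OF form_right[OF assms(1)] subspace_T assms]
      linear_on_subspaceD(1)[OF form_right[OF assms(2)] subspace_T assms] by simp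
  then show ?thesis
    using alternating assms vw by simp
qed

lemma form_J_left: "v \<in> T \<Longrightarrow> w \<in> T \<Longrightarrow> \<omega> v (J w) = - \<omega> (J v) w"
  using compatible[of "J v" w] form_minus[of v "J w"] J_J[of v] J_in by simp

sublocale inner_on T "\<lambda>v w. \<omega> (J v) w"
proof
  show "subspace T" by (rule subspace_T)
  show "linear_on_subspace T (\<lambda>v. \<omega> (J v) w)" if "w \<in> T" for w
    using J_linear form_left[OF that] J_in unfolding linear_on_subspace_def by auto
  show "\<omega> (J v) w = \<omega> (J w) v" if "v \<in> T" "w \<in> T" for v w
    using form_J_left[of w v] skew[of w "J v"] that J_in by simp
  show "\<omega> (J v) v > 0" if "v \<in> T" "v \<noteq> 0" for v
    using tamed that by blast
qed

lemma isotropic_span: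
  assumes "E \<subseteq> T" "\<And>e e'. e \<in> E \<Longrightarrow> e' \<in> E \<Longrightarrow> \<omega> e e' = 0" "v \<in> span E" "w \<in> span E"
  shows "\<omega> v w = 0"
proof -
  have right: "span E \<subseteq> {w \<in> T. \<omega> v w = 0}" if "v \<in> T" "\<And>e. e \<in> E \<Longrightarrow> \<omega> v e = 0" for v
  proof (rule span_minimal)
    show "E \<subseteq> {w \<in> T. \<omega> v w = 0}"
      using assms(1) that(2) by blast
    show "subspace {w \<in> T. \<omega> v w = 0}"
      using linear_on_subspaceD[OF form_right[OF that(1)] subspace_T] subspace_T
      unfolding subspace_def by auto
  qed
  have v: "v \<in> T"
    using span_minimal[OF assms(1) subspace_T] assms(3) by blast
  have "\<omega> e v = 0" if "e \<in> E" for e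
    using right[of e] assms that by blast
  then have "\<omega> v e = 0" if "e \<in> E" for e
    using skew[of v e] v that assms(1) by auto
  then show ?thesis
    using right[OF v] assms(4) by blast
qed

definition isotropic_orthonormal :: "'v set \<Rightarrow> bool" where
  "isotropic_orthonormal E \<longleftrightarrow> orthonormal E \<and> (\<forall>e\<in>E. \<forall>e'\<in>E. \<omega> e e' = 0)"

lemma J_inj_on: "inj_on J T"
  by (rule inj_onI) (metis J_J neg_equal_iff_equal)

lemma isotropic_orthonormal_image_J:
  assumes "isotropic_orthonormal E"
  shows "isotropic_orthonormal (J ` E)" "orthonormal (E \<union> J ` E)" "E \<inter> J ` E = {}"
proof -
  have E: "finite E" "E \<subseteq> T"
    and on: "\<And>e e'. e \<in> E \<Longrightarrow> e' \<in> E \<Longrightarrow> \<omega> (J e) e' = (if e = e' then 1 else 0)"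
    and iso: "\<And>e e'. e \<in> E \<Longrightarrow> e' \<in> E \<Longrightarrow> \<omega> e e' = 0"
    using assms unfolding isotropic_orthonormal_def orthonormal_def by auto
  have J_eq: "J e = J e' \<longleftrightarrow> e = e'" if "e \<in> E" "e' \<in> E" for e e'
    using J_inj_on E(2) that by (auto dest: inj_onD)
  have JJ: "\<omega> (J (J e)) (J e') = (if e = e' then 1 else 0)" if "e \<in> E" "e' \<in> E" for e e'
    using compatible[of "J e" e'] on[OF that] that E(2) J_in by (auto simp: subset_iff)
  have cross: "\<omega> (J e) (J e') = 0" "\<omega> (J (J e)) e' = 0" if "e \<in> E" "e' \<in> E" for e e'
    using compatible[of e e'] iso[OF that] form_minus[of e e'] J_J[of e] that E(2) by (auto simp: subset_iff)
  show disj: "E \<inter> J ` E = {}"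
  proof (rule ccontr)
    assume "E \<inter> J ` E \<noteq> {}"
    then obtain e e' where e: "e \<in> E" "e' \<in> E" "e = J e'" by blast
    then show False
      using on[of e e] cross(1)[of e e'] by auto
  qed
  show "isotropic_orthonormal (J ` E)"
    using E J_in JJ cross J_eq unfolding isotropic_orthonormal_def orthonormal_def by auto
  show "orthonormal (E \<union> J ` E)"
    using E J_in JJ cross J_eq on disj unfolding orthonormal_def by auto
qed

lemma isotropic_orthonormal_exists:
  assumes D: "finite D" "independent D" "span D = T" "card D = 2 * n"
  obtains E where "isotropic_orthonormal E" "card E = n" "span (E \<union> J ` E) = T"
proof -
  have "isotropic_orthonormal {}"
    by (simp add: isotropic_orthonormal_def orthonormal_def)
  moreover have "card E < Suc (card D)" if "isotropic_orthonormal E" for E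
  proof -
    have "independent E" "E \<subseteq> span D"
      using that orthonormal_independent D(3)
      by (auto simp: isotropic_orthonormal_def orthonormal_def)
    from independent_span_bound[OF D(1) this] show ?thesis by simp
  qed
  ultimately obtain E where E: "isotropic_orthonormal E"
    and max: "\<And>F. isotropic_orthonormal F \<Longrightarrow> card F \<le> card E"
    using ex_has_greatest_nat[of isotropic_orthonormal "{}" card "Suc (card D)"] by blast
  note EJ = isotropic_orthonormal_image_J[OF E]
  have ET: "E \<subseteq> T" "finite E"
    using E by (auto simp: isotropic_orthonormal_def orthonormal_def)
  have "T \<subseteq> span (E \<union> J ` E)"
  proof (rule ccontr)
    assume "\<not> T \<subseteq> span (E \<union> J ` E)"
    then obtain v where "v \<in> T" "v \<notin> span (E \<union> J ` E)" by blast
    from orthonormal_extend[OF EJ(2) this] obtain w where w: "w \<in> T" "\<omega> (J w) w = 1"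
      "\<And>e. e \<in> E \<union> J ` E \<Longrightarrow> \<omega> (J w) e = 0" by blast
    have wE: "\<omega> (J w) e = 0" "\<omega> (J e) w = 0" "\<omega> w e = 0" "\<omega> e w = 0" if "e \<in> E" for e
      using w(3)[of e] w(3)[of "J e"] compatible[of w e] skew[of e w] commute[of e w] that w(1) ET
      by auto
    have "w \<notin> E"
      using w wE(1) by auto
    moreover have "isotropic_orthonormal (insert w E)"
      using E w wE alternating[OF w(1)] \<open>w \<notin> E\<close>
      unfolding isotropic_orthonormal_def orthonormal_def by auto
    ultimately show False
      using max[of "insert w E"] ET(2) by simp
  qed
  then have sp: "span (E \<union> J ` E) = T"
    using span_minimal[OF _ subspace_T, of "E \<union> J ` E"] EJ(2) unfolding orthonormal_def by blast
  have "card (E \<union> J ` E) = dim T" "card D = dim T"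
    using dim_span_eq_card_independent orthonormal_independent[OF EJ(2)] D(2,3) sp by metis+
  moreover have "card (E \<union> J ` E) = card E + card E"
    using ET EJ(3) by (simp add: card_Un_disjoint card_image inj_on_subset[OF J_inj_on])
  ultimately have "card E = n"
    using D(4) by simp
  then show thesis
    using that E sp by blast
qed

end

section \<open>The Hessian\<close>

locale torsion_free_connection =
  fixes A :: "('a::topological_space, 'e::euclidean_space) chart set"
    and nabla :: "'a \<Rightarrow> 'a tvec \<Rightarrow> ('a \<Rightarrow> 'a tvec) \<Rightarrow> 'a tvec"
  assumes smooth_atlas: "smooth_atlas A"
    and linear_direction:
      "vector_field_near A x W \<Longrightarrow> linear_on_subspace (tangent_space A x) (\<lambda>v. nabla x v W)"
    and torsion_free: "vector_field_near A x V \<Longrightarrow> vector_field_near A x W \<Longrightarrow>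
      nabla x (V x) W - nabla x (W x) V = lie_bracket A V W x"
begin

lemma hessian_fields_commute:
  assumes "smooth_near A x f" "vector_field_near A x V" "vector_field_near A x W"
  shows "hessian_fields nabla f V W x = hessian_fields nabla f W V x"
proof -
  have "nabla x (V x) W f - nabla x (W x) V f = V x (\<lambda>y. W y f) - W x (\<lambda>y. V y f)"
    using fun_cong[OF torsion_free[OF assms(2,3)], of f] assms(1)
    by (simp add: lie_bracket_def)
  then show ?thesis
    by (simp add: hessian_fields_def)
qed

text \<open>
  The value is visibly tensorial in the first field, hence by symmetry also in the second one.
\<close>

lemma hessian_fields_cong:
  assumes "smooth_near A x f"
    and "vector_field_near A x V" "vector_field_near A x W"
    and "vector_field_near A x V'" "vector_field_near A x W'"
    and "V x = V' x" "W x = W' x"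
  shows "hessian_fields nabla f V W x = hessian_fields nabla f V' W' x"
proof -
  have "hessian_fields nabla f V W x = hessian_fields nabla f V' W x"
    using assms(6) by (simp add: hessian_fields_def)
  also have "\<dots> = hessian_fields nabla f W V' x"
    by (rule hessian_fields_commute[OF assms(1,4,3)])
  also have "\<dots> = hessian_fields nabla f W' V' x"
    using assms(7) by (simp add: hessian_fields_def)
  also have "\<dots> = hessian_fields nabla f V' W' x"
    by (rule hessian_fields_commute[OF assms(1,5,4)])
  finally show ?thesis .
qed

lemma hessian_eq:
  assumes "smooth_near A x f" "vector_field_near A x V" "vector_field_near A x W"
  shows "hessian A nabla f x (V x) (W x) = hessian_fields nabla f V W x"
  unfolding hessian_def
proof (rule the_equality)
  show "\<forall>V' W'. vector_field_near A x V' \<and> vector_field_near A x W' \<and> V' x = V x \<and> W' x = W x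
      \<longrightarrow> hessian_fields nabla f V' W' x = hessian_fields nabla f V W x"
    using hessian_fields_cong[OF assms(1)] assms(2,3) by blast
qed (use assms(2,3) in blast)

lemma hessian_commute:
  assumes "smooth_near A x f" "v \<in> tangent_space A x" "w \<in> tangent_space A x"
  shows "hessian A nabla f x v w = hessian A nabla f x w v"
proof -
  obtain V where V: "vector_field_near A x V" "V x = v"
    using tangent_vector_extends[OF smooth_atlas assms(2)] .
  obtain W where W: "vector_field_near A x W" "W x = w"
    using tangent_vector_extends[OF smooth_atlas assms(3)] .
  show ?thesis
    using hessian_eq[OF assms(1) V(1) W(1)] hessian_eq[OF assms(1) W(1) V(1)]
      hessian_fields_commute[OF assms(1) V(1) W(1)] V(2) W(2) by simp
qed

lemma hessian_linear_left:
  assumes f: "smooth_near A x f" and w: "w \<in> tangent_space A x"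
  shows "linear_on_subspace (tangent_space A x) (\<lambda>v. hessian A nabla f x v w)"
proof -
  obtain W where W: "vector_field_near A x W" "W x = w"
    using tangent_vector_extends[OF smooth_atlas w] .
  have eq: "hessian A nabla f x v w = v (\<lambda>y. W y f) - nabla x v W f"
    if v: "v \<in> tangent_space A x" for v
  proof -
    obtain V where "vector_field_near A x V" "V x = v"
      using tangent_vector_extends[OF smooth_atlas v] .
    then show ?thesis
      using hessian_eq[OF f _ W(1), of V] W(2) by (simp add: hessian_fields_def)
  qed
  show ?thesis
    unfolding linear_on_subspace_def
  proof (intro allI ballI)
    fix a b v v' assume v: "v \<in> tangent_space A x" "v' \<in> tangent_space A x"
    have av: "a *\<^sub>R v + b *\<^sub>R v' \<in> tangent_space A x"
      using v subspace_tangent_space[OF smooth_atlas] by (simp add: subspace_add subspace_scale)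
    have nabla: "nabla x (a *\<^sub>R v + b *\<^sub>R v') W = a *\<^sub>R nabla x v W + b *\<^sub>R nabla x v' W"
      using linear_direction[OF W(1)] v unfolding linear_on_subspace_def by blast
    show "hessian A nabla f x (a *\<^sub>R v + b *\<^sub>R v') w =
        a *\<^sub>R hessian A nabla f x v w + b *\<^sub>R hessian A nabla f x v' w"
      unfolding eq[OF av] eq[OF v(1)] eq[OF v(2)] nabla
      by (simp add: scaleR_fun_def right_diff_distrib)
  qed
qed

lemma hessian_linear_right:
  assumes f: "smooth_near A x f" and v: "v \<in> tangent_space A x"
  shows "linear_on_subspace (tangent_space A x) (hessian A nabla f x v)"
  unfolding linear_on_subspace_def
proof (intro allI ballI)
  fix a b w w' assume w: "w \<in> tangent_space A x" "w' \<in> tangent_space A x"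
  have "a *\<^sub>R w + b *\<^sub>R w' \<in> tangent_space A x"
    using w subspace_tangent_space[OF smooth_atlas] by (simp add: subspace_add subspace_scale)
  note commute = hessian_commute[OF f v this] hessian_commute[OF f v w(1)] hessian_commute[OF f v w(2)]
  show "hessian A nabla f x v (a *\<^sub>R w + b *\<^sub>R w') =
      a *\<^sub>R hessian A nabla f x v w + b *\<^sub>R hessian A nabla f x v w'"
    unfolding commute using hessian_linear_left[OF f v] w unfolding linear_on_subspace_def by blast
qed

end

section \<open>Splitting the Laplacian\<close>

lemma gromov_manifold_hermitian_on:
  assumes "gromov_manifold n A \<omega> J"
  shows "hermitian_on (tangent_space A x) (\<omega> x) (J x)"
proof
  have A: "smooth_atlas A"
    using assms unfolding gromov_manifold_def by blast
  show "subspace (tangent_space A x)"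
    by (rule subspace_tangent_space[OF A])
  have form: "smooth_2form A \<omega>" and J: "almost_complex_structure A J"
    using assms unfolding gromov_manifold_def symplectic_form_def by simp_all
  show "linear_on_subspace (tangent_space A x) (J x)"
    using J unfolding almost_complex_structure_def by simp
  fix v assume v: "v \<in> tangent_space A x"
  show "linear_on_subspace (tangent_space A x) (\<lambda>w. \<omega> x w v)"
    "linear_on_subspace (tangent_space A x) (\<omega> x v)" "\<omega> x v v = 0"
    using form v unfolding smooth_2form_def by simp_all
  show "J x v \<in> tangent_space A x" "J x (J x v) = - v"
    using J v unfolding almost_complex_structure_def by simp_all
  show "\<omega> x (J x v) (J x w) = \<omega> x v w" if "w \<in> tangent_space A x" for w
    using assms v that unfolding gromov_manifold_def by simp
  show "0 < \<omega> x (J x v) v" if "v \<noteq> 0"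
    using assms v that unfolding gromov_manifold_def by simp
qed

theorem lemma7p8:
  fixes n :: nat
    and A :: "('a::{t2_space, second_countable_topology}, 'e::euclidean_space) chart set"
    and \<omega> :: "'a \<Rightarrow> 'a tvec \<Rightarrow> 'a tvec \<Rightarrow> real"
    and J :: "'a \<Rightarrow> 'a tvec \<Rightarrow> 'a tvec"
    and nabla :: "'a \<Rightarrow> 'a tvec \<Rightarrow> ('a \<Rightarrow> 'a tvec) \<Rightarrow> 'a tvec"
    and u :: "'a \<Rightarrow> ereal"
  assumes "gromov_manifold n A \<omega> J"
    and "levi_civita_connection A (gromov_metric \<omega> J) nabla"
    and "upper_semicontinuous u"
    and "lagrangian_psh n A \<omega> J nabla u"
  shows "subharmonic A (gromov_metric \<omega> J) nabla u"
  unfolding subharmonic_def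
proof (intro conjI allI impI)
  show "upper_semicontinuous u" by fact
  fix x \<phi> assume test: "test_function A u x \<phi>"
  have A: "smooth_atlas A" and dim: "DIM('e) = 2 * n"
    using assms(1) unfolding gromov_manifold_def by blast+
  interpret torsion_free_connection A nabla
    using A assms(2) unfolding levi_civita_connection_def affine_connection_def
    by unfold_locales simp_all
  interpret H: hermitian_on "tangent_space A x" "\<omega> x" "J x"
    by (rule gromov_manifold_hermitian_on[OF assms(1)])
  obtain D where D: "finite D" "independent D" "span D = tangent_space A x" "card D = 2 * n"
    using tangent_space_basis[OF A] dim by metis
  obtain E where E: "H.isotropic_orthonormal E" "card E = n"
    and span: "span (E \<union> J x ` E) = tangent_space A x"
    using H.isotropic_orthonormal_exists[OF D] .
  note JE = H.isotropic_orthonormal_image_J[OF E(1)]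
  let ?B = "hessian A nabla \<phi> x"
  have \<phi>: "smooth_near A x \<phi>"
    using test by (simp add: test_function_def)
  have g: "gromov_metric \<omega> J x = (\<lambda>v w. \<omega> x (J x v) w)"
    by (simp add: gromov_metric_def fun_eq_iff)
  have trace: "trace_on (gromov_metric \<omega> J x) W ?B = (\<Sum>e\<in>F. ?B e e)"
    if "H.orthonormal F" "span F = W" for F W
    unfolding g
    by (rule H.trace_on_eq_sum[OF that hessian_linear_left[OF \<phi>] hessian_linear_right[OF \<phi>]])
  have lagrangian: "0 \<le> (\<Sum>e\<in>F. ?B e e)" if F: "H.isotropic_orthonormal F" "card F = n" for F
  proof -
    have on: "H.orthonormal F" and FT: "F \<subseteq> tangent_space A x"
      and iso: "\<And>e e'. e \<in> F \<Longrightarrow> e' \<in> F \<Longrightarrow> \<omega> x e e' = 0"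
      using F(1) by (auto simp: H.isotropic_orthonormal_def H.orthonormal_def)
    have "lagrangian_plane n A \<omega> x (span F)"
      unfolding lagrangian_plane_def
      using span_minimal[OF FT H.subspace_T] H.isotropic_span[OF FT iso]
        dim_span_eq_card_independent[OF H.orthonormal_independent[OF on]] F(2)
      by auto
    then have "0 \<le> trace_on (gromov_metric \<omega> J x) (span F) ?B"
      using assms(4) test unfolding lagrangian_psh_def by blast
    then show ?thesis
      using trace[OF on refl] by simp
  qed
  have fin: "finite E" "E \<subseteq> tangent_space A x"
    using E(1) by (auto simp: H.isotropic_orthonormal_def H.orthonormal_def)
  have "card (J x ` E) = n"
    using fin(2) E(2) by (simp add: card_image inj_on_subset[OF H.J_inj_on])
  then have "0 \<le> (\<Sum>e\<in>E. ?B e e) + (\<Sum>e\<in>J x ` E. ?B e e)"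
    using lagrangian[OF E] lagrangian[OF JE(1)] by simp
  also have "\<dots> = (\<Sum>e\<in>E \<union> J x ` E. ?B e e)"
    using fin(1) JE(3) by (simp add: sum.union_disjoint)
  also have "\<dots> = laplace_beltrami A (gromov_metric \<omega> J) nabla \<phi> x"
    unfolding laplace_beltrami_def using trace[OF JE(2) span] by simp
  finally show "0 \<le> laplace_beltrami A (gromov_metric \<omega> J) nabla \<phi> x" .
qed

end
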